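(* Let $n\ge 1$ be a fixed integer. For real parameters $A_1,\dots,A_n,B_1,\dots,B_n\ge 1$ there exists a set $$E=E(A_1,\dots,A_n,B_1,\dots,B_n)\subset\{(a_1,\dots,a_n,b_1,\dots,b_n)\in\mathbb Z^{2n}:\ 1\le a_i\le A_i,\ |b_i|\le B_i\}$$ such that $$|E|\sim 2^nA_1A_2\cdots A_nB_1B_2\cdots B_n\qquad\text{as all } A_i,B_i\to\infty,$$ and such that every rational number $r\in\{a_1^{b_1}a_2^{b_2}\cdots a_n^{b_n}:(a_1,\dots,a_n,b_1,\dots,b_n)\in E\}$ has a unique representation in $E$ up to permissible permutations; that is, if $(a_1,\dots,a_n,b_1,\dots,b_n)\in E$ and $(e_1,\dots,e_n,f_1,\dots,f_n)\in E$ satisfy $a_1^{b_1}\cdots a_n^{b_n}=e_1^{f_1}\cdots e_n^{f_n}$, then there is a permissible permutation $\sigma\in S_n$ with $e_i=a_{\sigma(i)}$ and $f_i=b_{\sigma(i)}$ for all $i$.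
   Context: Let $R=R(A_1,\dots,A_n,B_1,\dots,B_n)=\{r\in\mathbb Q: r=a_1^{b_1}\cdots a_n^{b_n},\ a_i,b_i\in\mathbb Z,\ 1\le a_i\le A_i,\ |b_i|\le B_i\}$. For $r\in R$ with a representation $r=a_1^{b_1}\cdots a_n^{b_n}$ (with $1\le a_i\le A_i$, $|b_i|\le B_i$), a permutation $\sigma\in S_n$ is said to permute $r$ (or to be a possible permutation for the $a_i^{b_i}$) if $1\le a_{\sigma(i)}\le A_i$ and $|b_{\sigma(i)}|\le B_i$ for all $i$. A permutation $\sigma\in S_n$ is called permissible if $|\{r\in R:\sigma \text{ permutes } r\}|\gg A_1\cdots A_nB_1\cdots B_n$ (i.e. is bounded below by a positive constant times $A_1\cdots A_nB_1\cdots B_n$) as the parameters tend to infinity.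
   Formalization: The set E and permissibility are relative to a given way (filter) of letting all A_i, B_i tend to infinity, and the bound ≫ is required only along some refinement of it (so "not permissible" means o(A_1⋯B_n)); with ≫ along the whole limit the claim fails, e.g. n=2, A_1=A_2, B_1=B_2. *)

theory Defs
  imports Complex_Main "HOL-Library.Landau_Symbols" "HOL-Library.Cardinality" "HOL-Combinatorics.Permutations"
begin

text \<open>
  Indices range over a finite type \<open>'n\<close>, so that \<open>n = CARD('n) \<ge> 1\<close>; a parameter point is a pair
  \<open>(A, B)\<close> of functions \<open>'n \<Rightarrow> real\<close>, and a tuple \<open>(a\<^sub>1, \<dots>, a\<^sub>n, b\<^sub>1, \<dots>, b\<^sub>n)\<close> is a pair \<open>(a, b)\<close>.
\<close>

definition rep_box :: "('n::finite \<Rightarrow> real) \<Rightarrow> ('n \<Rightarrow> real) \<Rightarrow> (('n \<Rightarrow> int) \<times> ('n \<Rightarrow> int)) set" where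
  "rep_box A B = {(a, b). \<forall>i. 1 \<le> a i \<and> of_int (a i) \<le> A i \<and> \<bar>of_int (b i)\<bar> \<le> B i}"

definition power_product :: "('n::finite \<Rightarrow> int) \<Rightarrow> ('n \<Rightarrow> int) \<Rightarrow> rat" where
  "power_product a b = (\<Prod>i\<in>UNIV. of_int (a i) powi b i)"

definition power_products :: "('n::finite \<Rightarrow> real) \<Rightarrow> ('n \<Rightarrow> real) \<Rightarrow> rat set" where
  "power_products A B = {r. \<exists>a b. (a, b) \<in> rep_box A B \<and> r = power_product a b}"

definition permutes_rat ::
  "('n::finite \<Rightarrow> real) \<Rightarrow> ('n \<Rightarrow> real) \<Rightarrow> ('n \<Rightarrow> 'n) \<Rightarrow> rat \<Rightarrow> bool" where
  "permutes_rat A B \<sigma> r \<longleftrightarrow> (\<exists>a b. (a, b) \<in> rep_box A B \<and> r = power_product a b \<and>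
     (\<forall>i. 1 \<le> a (\<sigma> i) \<and> of_int (a (\<sigma> i)) \<le> A i \<and> \<bar>of_int (b (\<sigma> i))\<bar> \<le> B i))"

definition permuted_count :: "('n::finite \<Rightarrow> 'n) \<Rightarrow> ('n \<Rightarrow> real) \<times> ('n \<Rightarrow> real) \<Rightarrow> real" where
  "permuted_count \<sigma> = (\<lambda>(A, B). real (card {r \<in> power_products A B. permutes_rat A B \<sigma> r}))"

definition param_prod :: "('n::finite \<Rightarrow> real) \<times> ('n \<Rightarrow> real) \<Rightarrow> real" where
  "param_prod = (\<lambda>(A, B). (\<Prod>i\<in>UNIV. A i) * (\<Prod>i\<in>UNIV. B i))"

text \<open>
  Whether a permutation is permissible depends on how the parameters tend to infinity relative to
  each other (a transposition of \<open>i, j\<close> is permissible if \<open>A i = A j\<close> and \<open>B i = B j\<close>, but not if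
  \<open>A i / A j \<rightarrow> \<infinity>\<close>). A way of letting all parameters tend to infinity is a filter on parameter
  points, for instance the image of \<open>sequentially\<close> under a sequence of parameter points.
\<close>

definition regime :: "(('n::finite \<Rightarrow> real) \<times> ('n \<Rightarrow> real)) filter \<Rightarrow> bool" where
  "regime F \<longleftrightarrow> F \<noteq> bot \<and>
     (\<forall>i. filterlim (\<lambda>(A, B). A i) at_top F) \<and> (\<forall>i. filterlim (\<lambda>(A, B). B i) at_top F)"

text \<open>
  The bound \<open>\<Omega>[G]\<close> is Vinogradov's \<open>\<ggreater>\<close> as the parameters tend to infinity along \<open>G\<close>. It is
  required along some refinement \<open>G\<close> of \<open>F\<close> in order that the permutations that are not permissible
  are exactly those permuting only \<open>o(A\<^sub>1 \<cdots> A\<^sub>n B\<^sub>1 \<cdots> B\<^sub>n)\<close> numbers, also if the proportion of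
  permuted numbers oscillates along \<open>F\<close> between \<open>0\<close> and a positive value; such a permutation cannot
  be dispensed with in the uniqueness statement. Whenever every permutation satisfies either the
  lower bound or the \<open>o\<close>-bound along \<open>F\<close> itself, one may take \<open>G = F\<close>; see
  \<open>permissible_iff_bigomega\<close> below.
\<close>

definition permissible ::
  "(('n::finite \<Rightarrow> real) \<times> ('n \<Rightarrow> real)) filter \<Rightarrow> ('n \<Rightarrow> 'n) \<Rightarrow> bool" where
  "permissible F \<sigma> \<longleftrightarrow> \<sigma> permutes UNIV \<and>
     (\<exists>G. G \<le> F \<and> G \<noteq> bot \<and> permuted_count \<sigma> \<in> \<Omega>[G](param_prod))"

lemma permissible_iff_not_smallo:
  "permissible F \<sigma> \<longleftrightarrow> \<sigma> permutes UNIV \<and> permuted_count \<sigma> \<notin> o[F](param_prod)"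
  if F: "regime F"
proof -
  have pos: "eventually (\<lambda>p. param_prod p > 0) F"
  proof -
    have "eventually (\<lambda>p. \<forall>i. fst p i > 0 \<and> snd p i > 0) F"
      using F unfolding regime_def filterlim_at_top_dense case_prod_beta
      by (auto intro!: eventually_all_finite eventually_conj)
    then show ?thesis
      by eventually_elim (auto simp: param_prod_def case_prod_beta intro!: mult_pos_pos prod_pos)
  qed
  have "(\<exists>G. G \<le> F \<and> G \<noteq> bot \<and> permuted_count \<sigma> \<in> \<Omega>[G](param_prod)) \<longleftrightarrow>
    permuted_count \<sigma> \<notin> o[F](param_prod)" (is "?L \<longleftrightarrow> ?R")
  proof
    assume ?L
    then obtain G c where G: "G \<le> F" "G \<noteq> bot" and c: "c > 0"
      "eventually (\<lambda>p. norm (permuted_count \<sigma> p) \<ge> c * norm (param_prod p)) G"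
      by (auto elim: landau_omega.bigE)
    show ?R
    proof
      assume "permuted_count \<sigma> \<in> o[F](param_prod)"
      then have "eventually (\<lambda>p. norm (permuted_count \<sigma> p) \<le> c / 2 * norm (param_prod p)) F"
        using c(1) by (intro landau_o.smallD) auto
      then have "eventually (\<lambda>p. norm (permuted_count \<sigma> p) \<le> c / 2 * norm (param_prod p)
          \<and> param_prod p > 0) G"
        using pos G(1) by (auto simp: le_filter_def intro: eventually_conj)
      with c(2) have "eventually (\<lambda>p. False) G"
      proof eventually_elim
        case (elim p)
        then have "c * norm (param_prod p) \<le> c / 2 * norm (param_prod p)"
          by (meson order_trans)
        then have "c * param_prod p \<le> c / 2 * param_prod p" using elim by simp
        moreover have "c * param_prod p > 0" using elim c(1) by simp
        ultimately show ?case by simp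
      qed
      with G(2) show False by simp
    qed
  next
    assume ?R
    then obtain c where c: "c > 0"
      "\<not> eventually (\<lambda>p. norm (permuted_count \<sigma> p) \<le> c * norm (param_prod p)) F"
      using landau_o.smallI by blast
    define G where "G = inf F (principal {p. norm (permuted_count \<sigma> p) \<ge> c * norm (param_prod p)})"
    have "G \<noteq> bot"
    proof
      assume "G = bot"
      then have "eventually (\<lambda>p. \<not> norm (permuted_count \<sigma> p) \<ge> c * norm (param_prod p)) F"
        by (simp add: G_def trivial_limit_def eventually_inf_principal)
      then have "eventually (\<lambda>p. norm (permuted_count \<sigma> p) \<le> c * norm (param_prod p)) F"
        by eventually_elim simp
      with c(2) show False by simp
    qed
    moreover have "permuted_count \<sigma> \<in> \<Omega>[G](param_prod)"
      using c(1) by (intro landau_omega.bigI[of c]) (auto simp: G_def eventually_inf_principal)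
    moreover have "G \<le> F" by (simp add: G_def)
    ultimately show ?L by blast
  qed
  then show ?thesis by (auto simp: permissible_def)
qed

lemma permissible_iff_bigomega:
  assumes F: "regime F"
    and "permuted_count \<sigma> \<in> \<Omega>[F](param_prod) \<or> permuted_count \<sigma> \<in> o[F](param_prod)"
  shows "permissible F \<sigma> \<longleftrightarrow> \<sigma> permutes UNIV \<and> permuted_count \<sigma> \<in> \<Omega>[F](param_prod)"
proof -
  have "F \<noteq> bot" using F by (simp add: regime_def)
  then show ?thesis
    using assms permissible_iff_not_smallo[OF F, of \<sigma>] unfolding permissible_def by blast
qed

end

(*
  For almost all tuples in the box, the b_i satisfy no nontrivial linear relation with bounded integer
  coefficients, and no d > K satisfies d^2 | a_i or d | a_i, d | a_j with i ~= j (the exceptions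
  have density at most n^2 / K + o(1)). Suppose that two such tuples (a, b), (e, f) represent the same
  number. The valuation at a prime p > K dividing a_i is b_i on the one side and an f_j on the other,
  which matches the exponents by a permutation; comparing the valuations at any prime then gives a
  linear relation between the b_i with bounded coefficients, so that the bases match too.
  This gives a set of almost full size with uniqueness up to arbitrary permutations. In it, the
  tuples that are permuted by a non-permissible permutation are at most n! times as many as
  the numbers they represent, hence negligible, and they can be removed.
*)
theory Submission
  imports Defs "HOL-Computational_Algebra.Primes" "HOL-Real_Asymp.Real_Asymp"
    "HOL-Library.FuncSet"
begin

section \<open>Generic tuples and valuations of power products\<close>

text \<open>
  The condition with \<open>d\<^sup>2\<close> forces all multiplicities to be less than \<open>2 * K\<close>, also at primes
  \<open>p \<le> K\<close>, because \<open>p ^ K > K\<close>; a \<open>K\<close>-smooth base would therefore divide \<open>fact K ^ (2 * K)\<close>.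
\<close>

definition generic_bases :: "nat \<Rightarrow> ('n::finite \<Rightarrow> int) set" where
  "generic_bases K = {a. (\<forall>i. fact K ^ (2 * K) < a i) \<and>
     (\<forall>i j d. int K < d \<longrightarrow> \<not> (if i = j then d\<^sup>2 dvd a i else d dvd a i \<and> d dvd a j))}"

text \<open>The relations to be excluded have differences of two multiplicities of generic bases as
  coefficients; this is where the bound \<open>2 * int K\<close> comes from.\<close>

definition generic_exponents :: "nat \<Rightarrow> ('n::finite \<Rightarrow> int) set" where
  "generic_exponents K = {b. \<forall>c. (\<forall>i. \<bar>c i\<bar> \<le> 2 * int K) \<longrightarrow> (\<Sum>i\<in>UNIV. c i * b i) = 0 \<longrightarrow> (\<forall>i. c i = 0)}"

text \<open>For each \<open>i\<close> one of \<open>nat (b i)\<close> and \<open>nat (- b i)\<close>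
  is 0, so the factors are sorted into a numerator and a denominator. Cross-multiplication then
  turns equalities of rationals into equalities of integers.\<close>

lemma power_product_eq_divide:
  assumes "\<forall>i. a i \<noteq> 0"
  shows "power_product a b =
    of_int (\<Prod>i\<in>UNIV. a i ^ nat (b i)) / of_int (\<Prod>i\<in>UNIV. a i ^ nat (- b i))"
proof -
  have "of_int (a i) powi b i = (of_int (a i) ^ nat (b i) / of_int (a i) ^ nat (- b i) :: rat)" for i
    by (auto simp: power_int_def divide_simps)
  then show ?thesis
    by (simp add: power_product_def prod_dividef)
qed

lemma multiplicity_prod_power:
  fixes a :: "'n::finite \<Rightarrow> int"
  assumes "prime p" "\<forall>i. a i \<noteq> 0"
  shows "multiplicity p (\<Prod>i\<in>UNIV. a i ^ k i) = (\<Sum>i\<in>UNIV. k i * multiplicity p (a i))"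
proof -
  have "multiplicity p (\<Prod>i\<in>UNIV. a i ^ k i) = (\<Sum>i\<in>UNIV. multiplicity p (a i ^ k i))"
    using assms by (intro prime_elem_multiplicity_prod_distrib) auto
  also have "\<dots> = (\<Sum>i\<in>UNIV. k i * multiplicity p (a i))"
    using assms by (intro sum.cong) (auto simp: prime_elem_multiplicity_power_distrib)
  finally show ?thesis .
qed

text \<open>Both sides are p-adic valuations of the same rational number, computed with
  \<open>multiplicity\<close> on integers after clearing denominators.\<close>

lemma power_product_eq_imp_multiplicity:
  fixes a b e f :: "'n::finite \<Rightarrow> int"
  assumes eq: "power_product a b = power_product e f" and p: "prime p"
    and a: "\<forall>i. a i \<noteq> 0" and e: "\<forall>i. e i \<noteq> 0"
  shows "(\<Sum>i\<in>UNIV. b i * int (multiplicity p (a i))) = (\<Sum>i\<in>UNIV. f i * int (multiplicity p (e i)))"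
proof -
  let ?pr = "\<lambda>(a::'n \<Rightarrow> int) k. \<Prod>i\<in>UNIV. a i ^ k i"
  let ?bp = "\<lambda>i. nat (b i)" and ?bm = "\<lambda>i. nat (- b i)"
  let ?fp = "\<lambda>i. nat (f i)" and ?fm = "\<lambda>i. nat (- f i)"
  have nz: "?pr a k \<noteq> 0" "?pr e k \<noteq> 0" for k using a e by auto
  have "(of_int (?pr a ?bp) :: rat) / of_int (?pr a ?bm) = of_int (?pr e ?fp) / of_int (?pr e ?fm)"
    using eq unfolding power_product_eq_divide[OF a] power_product_eq_divide[OF e] .
  then have "(of_int (?pr a ?bp) :: rat) * of_int (?pr e ?fm) = of_int (?pr e ?fp) * of_int (?pr a ?bm)"
    by (rule frac_eq_eq[THEN iffD1, rotated 2]) (simp_all only: of_int_eq_0_iff nz not_False_eq_True)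
  then have "?pr a ?bp * ?pr e ?fm = ?pr e ?fp * ?pr a ?bm"
    by (simp only: of_int_eq_iff of_int_mult [symmetric])
  then have "multiplicity p (?pr a ?bp * ?pr e ?fm) = multiplicity p (?pr e ?fp * ?pr a ?bm)"
    by (rule arg_cong)
  then have "multiplicity p (?pr a ?bp) + multiplicity p (?pr e ?fm) =
      multiplicity p (?pr e ?fp) + multiplicity p (?pr a ?bm)"
    unfolding prime_elem_multiplicity_mult_distrib[OF prime_imp_prime_elem[OF p] nz(1) nz(2)]
      prime_elem_multiplicity_mult_distrib[OF prime_imp_prime_elem[OF p] nz(2) nz(1)] .
  then have *: "int (\<Sum>i\<in>UNIV. ?bp i * multiplicity p (a i)) + int (\<Sum>i\<in>UNIV. ?fm i * multiplicity p (e i)) =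
      int (\<Sum>i\<in>UNIV. ?fp i * multiplicity p (e i)) + int (\<Sum>i\<in>UNIV. ?bm i * multiplicity p (a i))"
    unfolding multiplicity_prod_power[OF p a] multiplicity_prod_power[OF p e] by linarith
  \<comment> \<open>This undoes the truncations by \<open>nat\<close>: an integer coefficient is its
    positive part minus its negative part.\<close>
  have split: "(\<Sum>i\<in>UNIV. c i * int (m i)) =
      int (\<Sum>i\<in>UNIV. nat (c i) * m i) - int (\<Sum>i\<in>UNIV. nat (- c i) * m i)" for c :: "'n \<Rightarrow> int" and m
  proof -
    have "c i * int (m i) = int (nat (c i)) * int (m i) - int (nat (- c i)) * int (m i)" for i
      by (cases "c i \<ge> 0") auto
    then show ?thesis by (simp add: sum_subtractf)
  qed
  show ?thesis unfolding split using * by linarith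
qed

section \<open>Uniqueness of generic representations up to arbitrary permutations\<close>

lemma generic_basesD1: "a \<in> generic_bases K \<Longrightarrow> fact K ^ (2 * K) < a i"
  unfolding generic_bases_def by blast

lemma generic_basesD2:
  assumes "a \<in> generic_bases K" "int K < d"
  shows "\<not> (if i = j then d\<^sup>2 dvd a i else d dvd a i \<and> d dvd a j)"
  using assms unfolding generic_bases_def by blast

lemma generic_bases_pos: "a \<in> generic_bases K \<Longrightarrow> a i > 0"
  by (rule order.strict_trans[OF _ generic_basesD1]) auto

text \<open>Otherwise the square of \<open>d = p ^ K\<close> divides \<open>a i\<close>, and this
  \<open>d\<close> exceeds \<open>K\<close> even for \<open>p = 2\<close>. The alternative 0 is
  there for \<open>K = 0\<close>, where nothing is below \<open>2 * K\<close>.\<close>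

lemma generic_bases_multiplicity_less:
  assumes a: "a \<in> generic_bases K" and p: "prime p"
  shows "multiplicity p (a i) < 2 * K \<or> multiplicity p (a i) = 0"
proof (rule ccontr)
  assume "\<not> ?thesis"
  then have "K > 0 \<or> multiplicity p (a i) > 0" "2 * K \<le> multiplicity p (a i)" by auto
  then have "(p ^ K)\<^sup>2 dvd a i"
    by (simp add: multiplicity_dvd' power_mult [symmetric] mult.commute)
  moreover have "int K < p ^ K"
  proof -
    have "int K < 2 ^ K" by (metis less_exp of_nat_less_numeral_power_cancel_iff)
    also have "2 ^ K \<le> p ^ K" using p by (intro power_mono) (auto simp: prime_ge_2_int)
    finally show ?thesis .
  qed
  ultimately show False using generic_basesD2[OF a, of "p ^ K" i i] by simp
qed

text \<open>The prime found here serves as a marker of the position \<open>i\<close> among the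
  bases.\<close>

lemma generic_bases_large_prime:
  assumes a: "a \<in> generic_bases K"
  obtains p where "prime p" "p dvd a i" "int K < p"
proof -
  have "\<exists>p. prime p \<and> p dvd a i \<and> int K < p"
  proof (rule ccontr)
    assume "\<not> ?thesis"
    then have small: "\<And>p. prime p \<Longrightarrow> p dvd a i \<Longrightarrow> p \<le> int K" by (meson not_le)
    have "a i dvd fact K ^ (2 * K)"
    proof (rule multiplicity_le_imp_dvd)
      show "a i \<noteq> 0" using generic_bases_pos[OF a, of i] by simp
      fix p :: int assume p: "prime p"
      show "multiplicity p (a i) \<le> multiplicity p (fact K ^ (2 * K))"
      proof (cases "p dvd a i")
        case True
        with p small have "p \<le> int K" by blast
        moreover have "int (nat p) = p" using prime_gt_0_int[OF p] by simp
        moreover have "nat p dvd fact K"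
          using prime_gt_0_int[OF p] \<open>p \<le> int K\<close> by (intro dvd_fact) auto
        ultimately have "p dvd fact K" by (metis int_dvd_int_iff of_nat_fact)
        then have "p ^ (2 * K) dvd fact K ^ (2 * K)" by (rule dvd_power_same)
        then have "2 * K \<le> multiplicity p (fact K ^ (2 * K))"
          using p by (intro multiplicity_geI) auto
        then show ?thesis using generic_bases_multiplicity_less[OF a p, of i] by auto
      qed (simp add: not_dvd_imp_multiplicity_0)
    qed
    then have "a i \<le> fact K ^ (2 * K)" by (rule zdvd_imp_le) simp
    then show False using generic_basesD1[OF a, of i] by simp
  qed
  then show thesis using that by blast
qed

text \<open>Genericity is applied with \<open>d = p\<close>. At such a prime, the valuation of a
  power product with bases \<open>a\<close> reads off the single exponent at
  \<open>i\<close>.\<close>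

lemma generic_bases_multiplicity_eq:
  assumes a: "a \<in> generic_bases K" and p: "prime p" "p dvd a i" "int K < p"
  shows "multiplicity p (a j) = (if j = i then 1 else 0)"
proof (cases "j = i")
  case True
  have "\<not> p ^ Suc 1 dvd a i" using generic_basesD2[OF a p(3), of i i] by (simp add: power2_eq_square)
  then have "multiplicity p (a i) = 1" using p by (intro multiplicity_eqI) auto
  then show ?thesis using True by simp
next
  case False
  then have "\<not> p dvd a j" using generic_basesD2[OF a p(3), of j i] p(2) by simp
  then show ?thesis using False by (simp add: not_dvd_imp_multiplicity_0)
qed

text \<open>A zero entry would satisfy the relation given by a unit vector. Nonzero exponents
  guarantee that the marker prime of a base is visible in the valuation of the power
  product.\<close>

lemma generic_exponents_nonzero:
  assumes b: "b \<in> generic_exponents K" and K: "K > 0"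
  shows "b i \<noteq> 0"
proof
  assume bi: "b i = 0"
  define c :: "_ \<Rightarrow> int" where "c = (\<lambda>k. if k = i then 1 else 0)"
  have "(\<Sum>k\<in>UNIV. c k * b k) = 0" unfolding c_def using bi
    by (simp add: if_distribR if_distrib cong: if_cong)
  moreover have "\<bar>c k\<bar> \<le> 2 * int K" for k using K by (auto simp: c_def)
  ultimately have "c i = 0" using b unfolding generic_exponents_def by blast
  then show False by (simp add: c_def)
qed

text \<open>Two equal entries would satisfy a relation with coefficients 1 and -1. Injectivity is
  what later turns the matching of exponents into a bijection.\<close>

lemma generic_exponents_inj:
  assumes b: "b \<in> generic_exponents K" and K: "K > 0"
  shows "inj b"
proof (rule injI, rule ccontr)
  fix i j assume eq: "b i = b j" and ne: "i \<noteq> j"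
  define c :: "_ \<Rightarrow> int" where "c = (\<lambda>k. (if k = i then 1 else 0) - (if k = j then 1 else 0))"
  have "(\<Sum>k\<in>UNIV. c k * b k) = 0" unfolding c_def left_diff_distrib sum_subtractf using eq
    by (simp add: if_distribR if_distrib cong: if_cong)
  moreover have "\<bar>c k\<bar> \<le> 2 * int K" for k using K by (auto simp: c_def)
  ultimately have "c i = 0" using b unfolding generic_exponents_def by blast
  then show False using ne by (simp add: c_def)
qed

lemma generic_representation_unique:
  fixes a b e f :: "'n::finite \<Rightarrow> int"
  assumes K: "K > 0"
    and a: "a \<in> generic_bases K" and b: "b \<in> generic_exponents K"
    and e: "e \<in> generic_bases K" and f: "f \<in> generic_exponents K"
    and eq: "power_product a b = power_product e f"
  shows "\<exists>\<sigma>. \<sigma> permutes UNIV \<and> e = a \<circ> \<sigma> \<and> f = b \<circ> \<sigma>"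
proof -
  have val: "(\<Sum>i\<in>UNIV. b i * int (multiplicity p (a i))) = (\<Sum>i\<in>UNIV. f i * int (multiplicity p (e i)))"
    if "prime p" for p
    using power_product_eq_imp_multiplicity[OF eq that] generic_bases_pos[OF a] generic_bases_pos[OF e]
    by (metis less_irrefl)
  \<comment> \<open>At a marker prime of \<open>a i\<close> the left valuation is
    \<open>b i\<close>. As this is nonzero, the prime divides some \<open>e j\<close>, and then the
    right valuation is \<open>f j\<close>.\<close>
  have "\<exists>j. b i = f j" for i
  proof -
    obtain p where p: "prime p" "p dvd a i" "int K < p"
      using generic_bases_large_prime[OF a] by blast
    have bi: "b i = (\<Sum>j\<in>UNIV. f j * int (multiplicity p (e j)))"
      unfolding val[OF p(1), symmetric] generic_bases_multiplicity_eq[OF a p]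
      by (simp add: if_distrib cong: if_cong)
    have "\<exists>j. p dvd e j"
    proof (rule ccontr)
      assume "\<nexists>j. p dvd e j"
      then have "b i = 0" unfolding bi by (simp add: not_dvd_imp_multiplicity_0)
      then show False using generic_exponents_nonzero[OF b K] by blast
    qed
    then obtain j where j: "p dvd e j" ..
    have "b i = f j"
      unfolding bi generic_bases_multiplicity_eq[OF e p(1) j p(3)]
      by (simp add: if_distrib cong: if_cong)
    then show ?thesis ..
  qed
  then obtain \<tau> where \<tau>: "\<And>i. b i = f (\<tau> i)" by metis
  have "inj \<tau>" by (rule injI) (metis \<tau> generic_exponents_inj[OF b K] injD)
  then have bij: "bij \<tau>" by (simp add: finite_UNIV_inj_surj bij_def)
  have mult_eq: "multiplicity p (a i) = multiplicity p (e (\<tau> i))" if p: "prime p" for p i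
  proof -
    \<comment> \<open>Here \<open>p\<close> is any prime, possibly at most \<open>K\<close>. Once
      the exponents are matched, equality of valuations is a linear relation between the
      \<open>b i\<close> with coefficients \<open>c i\<close>, small enough to be excluded by
      genericity.\<close>
    define c where "c i = int (multiplicity p (a i)) - int (multiplicity p (e (\<tau> i)))" for i
    have "(\<Sum>i\<in>UNIV. b i * int (multiplicity p (a i))) =
        (\<Sum>i\<in>UNIV. f (\<tau> i) * int (multiplicity p (e (\<tau> i))))"
      unfolding val[OF p]
      by (rule sum.reindex_bij_betw[OF bij, symmetric, where g = "\<lambda>j. f j * int (multiplicity p (e j))"])
    then have "(\<Sum>i\<in>UNIV. b i * c i) = 0"
      by (simp add: c_def right_diff_distrib sum_subtractf \<tau>)
    then have "(\<Sum>i\<in>UNIV. c i * b i) = 0"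
      by (simp only: mult.commute)
    moreover have "\<bar>c i\<bar> \<le> 2 * int K" for i
      using generic_bases_multiplicity_less[OF a p, of i]
        generic_bases_multiplicity_less[OF e p, of "\<tau> i"] unfolding c_def by auto
    ultimately have "c i = 0" using b unfolding generic_exponents_def by blast
    then show ?thesis by (simp add: c_def)
  qed
  have ae: "a i = e (\<tau> i)" for i
  proof -
    have "normalize (a i) = normalize (e (\<tau> i))"
      using mult_eq generic_bases_pos[OF a, of i] generic_bases_pos[OF e, of "\<tau> i"]
      by (intro multiplicity_eq_imp_eq) auto
    then show ?thesis
      using generic_bases_pos[OF a, of i] generic_bases_pos[OF e, of "\<tau> i"] by simp
  qed
  \<comment> \<open>The map \<open>\<tau>\<close> expresses \<open>(a, b)\<close> through
    \<open>(e, f)\<close>; the claim asks for the opposite direction.\<close>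
  have "inv \<tau> permutes UNIV" using bij by (intro bij_imp_permutes) (auto simp: bij_imp_bij_inv)
  moreover have "e = a \<circ> inv \<tau>" "f = b \<circ> inv \<tau>"
    using ae \<tau> bij by (auto simp: fun_eq_iff bij_is_surj surj_f_inv_f)
  ultimately show ?thesis by blast
qed

section \<open>Counting nongeneric bases\<close>

text \<open>The weights bound the relative sizes coordinate by coordinate; they will be 1 except at
  the one or two constrained coordinates. \<open>T k\<close> may fail to be a subset of
  \<open>S k\<close>, as happens for a range of small bases that is longer than the box.\<close>

lemma card_PiE_le_weighted:
  fixes S T :: "'n::finite \<Rightarrow> int set" and w :: "'n \<Rightarrow> real"
  assumes "\<And>k. real (card (T k)) \<le> w k * real (card (S k))"
  shows "real (card (Pi\<^sub>E UNIV T)) \<le> (\<Prod>k\<in>UNIV. w k) * real (card (Pi\<^sub>E UNIV S))"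
  using assms by (simp add: card_PiE prod.distrib [symmetric] prod_mono)

text \<open>Counting from 1 gives the quotient rounded down, without an error term. The bound can
  therefore be summed over arbitrarily many \<open>d\<close>.\<close>

lemma card_multiples_le:
  fixes d N :: int
  assumes "d > 0" "N \<ge> 0"
  shows "real (card {x \<in> {1..N}. d dvd x}) \<le> 1 / of_int d * real (card {1..N})"
proof -
  have "{x \<in> {1..N}. d dvd x} \<subseteq> (*) d ` {1..N div d}"
  proof
    fix x assume "x \<in> {x \<in> {1..N}. d dvd x}"
    then obtain q where q: "x = d * q" "1 \<le> d * q" "d * q \<le> N" by auto
    have "q \<ge> 1" using q(2) assms(1) by (smt (verit) mult_nonneg_nonpos)
    moreover have "q \<le> N div d" using q(3) assms(1) by (metis zdiv_mono1 nonzero_mult_div_cancel_left order_less_irrefl)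
    ultimately show "x \<in> (*) d ` {1..N div d}" using q(1) by auto
  qed
  then have "card {x \<in> {1..N}. d dvd x} \<le> card ((*) d ` {1..N div d})" by (intro card_mono) auto
  also have "\<dots> \<le> card {1..N div d}" by (rule card_image_le) simp
  finally have "int (card {x \<in> {1..N}. d dvd x}) \<le> N div d"
    using assms by (simp add: pos_imp_zdiv_nonneg_iff le_nat_iff)
  then have "real (card {x \<in> {1..N}. d dvd x}) \<le> of_int (N div d)" by linarith
  also have "\<dots> \<le> of_int N / of_int d" by (rule real_of_int_div4)
  finally show ?thesis using assms by simp
qed

lemma card_common_multiples_le:
  fixes N :: "'n::finite \<Rightarrow> int"
  assumes N: "\<And>k. N k \<ge> 0" and d: "d > 0"
  shows "real (card {a \<in> Pi\<^sub>E UNIV (\<lambda>k. {1..N k}). if i = j then d\<^sup>2 dvd a i else d dvd a i \<and> d dvd a j})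
    \<le> 1 / of_int d ^ 2 * real (card (Pi\<^sub>E UNIV (\<lambda>k. {1..N k})))"
proof -
  \<comment> \<open>One divisibility condition per coordinate covers both cases: for
    \<open>i = j\<close> the two factors meet at one coordinate and give the square, and the product
    over all coordinates is always the square of \<open>d\<close>.\<close>
  define m where "m k = (if k = i then d else 1) * (if k = j then d else 1)" for k
  have "{a \<in> Pi\<^sub>E UNIV (\<lambda>k. {1..N k}). if i = j then d\<^sup>2 dvd a i else d dvd a i \<and> d dvd a j}
      \<subseteq> Pi\<^sub>E UNIV (\<lambda>k. {x \<in> {1..N k}. m k dvd x})"
    by (auto simp: m_def PiE_iff power2_eq_square split: if_splits)
  then have "card {a \<in> Pi\<^sub>E UNIV (\<lambda>k. {1..N k}). if i = j then d\<^sup>2 dvd a i else d dvd a i \<and> d dvd a j}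
      \<le> card (Pi\<^sub>E UNIV (\<lambda>k. {x \<in> {1..N k}. m k dvd x}))"
    by (intro card_mono finite_PiE finite_Collect_conjI) auto
  also have "real \<dots> \<le> (\<Prod>k\<in>UNIV. 1 / of_int (m k)) * real (card (Pi\<^sub>E UNIV (\<lambda>k. {1..N k})))"
    using N d by (intro card_PiE_le_weighted card_multiples_le) (auto simp: m_def)
  also have "(\<Prod>k\<in>UNIV. 1 / real_of_int (m k)) = 1 / of_int (\<Prod>k\<in>UNIV. m k)"
    by (simp add: prod_dividef)
  also have "(\<Prod>k\<in>UNIV. m k) = d ^ 2"
    unfolding m_def prod.distrib by (simp add: power2_eq_square)
  finally show ?thesis by simp
qed

text \<open>The sum is compared with a telescoping one, using 1/(x+1)^2 <= 1/x - 1/(x+1). The bound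
  is uniform in \<open>D\<close>, which will depend on the box.\<close>

lemma sum_inverse_squares_le:
  assumes "K > 0"
  shows "(\<Sum>d\<in>{K<..D}. 1 / real d ^ 2) \<le> 1 / real K"
proof -
  have partial: "(\<Sum>d\<in>{K<..K + k}. 1 / real d ^ 2) \<le> 1 / real K - 1 / real (K + k)" for k
  proof (induction k)
    case (Suc k)
    have "{K<..K + Suc k} = insert (K + Suc k) {K<..K + k}" by auto
    then have "(\<Sum>d\<in>{K<..K + Suc k}. 1 / real d ^ 2) =
        (\<Sum>d\<in>{K<..K + k}. 1 / real d ^ 2) + 1 / real (K + Suc k) ^ 2" by simp
    also have "1 / real (K + Suc k) ^ 2 \<le> 1 / real (K + k) - 1 / real (K + Suc k)"
    proof -
      define x where "x = real (K + k)"
      have "x > 0" using assms by (simp add: x_def)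
      then have "1 / (x + 1) ^ 2 \<le> 1 / x - 1 / (x + 1)"
        by (simp add: divide_simps power2_eq_square)
      then show ?thesis by (simp add: x_def add_ac)
    qed
    finally show ?case using Suc by linarith
  qed simp
  show ?thesis
  proof (cases "K \<le> D")
    case True
    then have "(\<Sum>d\<in>{K<..D}. 1 / real d ^ 2) \<le> 1 / real K - 1 / real D"
      using partial[of "D - K"] by simp
    also have "\<dots> \<le> 1 / real K" by simp
    finally show ?thesis .
  qed simp
qed

text \<open>A union bound: the first term collects the pairs of positions and all
  \<open>d > K\<close>, the second the bases that are too small. The first is independent of the box
  and is controlled by \<open>K\<close> alone.\<close>

lemma card_nongeneric_bases_le:
  fixes N :: "'n::finite \<Rightarrow> int"
  assumes N: "\<And>k. N k \<ge> 1" and K: "K > 0"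
  shows "real (card (Pi\<^sub>E UNIV (\<lambda>k. {1..N k}) - generic_bases K))
    \<le> (real CARD('n) ^ 2 / real K + (\<Sum>i\<in>UNIV. fact K ^ (2 * K) / of_int (N i))) *
      real (card (Pi\<^sub>E UNIV (\<lambda>k. {1..N k})))"
proof -
  let ?X = "Pi\<^sub>E UNIV (\<lambda>k. {1..N k})"
  define H :: int where "H = fact K ^ (2 * K)"
  have H: "H > 0" by (simp add: H_def)
  \<comment> \<open>A bad \<open>d\<close> divides some \<open>a i\<close> and hence is at most
    \<open>N i\<close>, so finitely many \<open>d\<close> suffice. The cutoff is crude but
    disappears from the final bound.\<close>
  define D where "D = nat (\<Sum>k\<in>UNIV. N k)"
  define small where "small i = {a \<in> ?X. a i \<le> H}" for i
  define common where "common d ij =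
    {a \<in> ?X. if fst ij = snd ij then (int d)\<^sup>2 dvd a (fst ij) else int d dvd a (fst ij) \<and> int d dvd a (snd ij)}" for d ij
  have fin: "finite ?X" by (intro finite_PiE) auto
  have "?X - generic_bases K \<subseteq> (\<Union>i. small i) \<union> (\<Union>d\<in>{K<..D}. \<Union>ij. common d ij)"
  proof
    fix a assume a: "a \<in> ?X - generic_bases K"
    then have a1: "1 \<le> a k" "a k \<le> N k" for k by (auto simp: PiE_iff)
    show "a \<in> (\<Union>i. small i) \<union> (\<Union>d\<in>{K<..D}. \<Union>ij. common d ij)"
    proof (cases "\<exists>i. a i \<le> H")
      case True
      then show ?thesis using a by (auto simp: small_def)
    next
      case False
      then have "\<forall>i. fact K ^ (2 * K) < a i" by (auto simp: H_def not_le)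
      then obtain i j d where ijd: "int K < d" "if i = j then d\<^sup>2 dvd a i else d dvd a i \<and> d dvd a j"
        using a unfolding generic_bases_def by blast
      then have "d dvd a i" by (auto split: if_splits simp: power2_eq_square dest: dvd_mult_left)
      then have "d \<le> a i" using a1(1)[of i] by (intro zdvd_imp_le) auto
      also have "a i \<le> N i" by (rule a1)
      also have "N i \<le> (\<Sum>k\<in>UNIV. N k)" using N by (intro member_le_sum) (auto intro: order_trans[of 0 1])
      finally have "nat d \<in> {K<..D}" using ijd(1) by (auto simp: D_def)
      moreover have "a \<in> common (nat d) (i, j)" using a ijd by (auto simp: common_def)
      ultimately show ?thesis by blast
    qed
  qed
  then have "card (?X - generic_bases K) \<le> card ((\<Union>i. small i) \<union> (\<Union>d\<in>{K<..D}. \<Union>ij. common d ij))"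
    using fin by (intro card_mono) (auto simp: small_def common_def)
  also have "\<dots> \<le> card (\<Union>i. small i) + card (\<Union>d\<in>{K<..D}. \<Union>ij. common d ij)" by (rule card_Un_le)
  also have "\<dots> \<le> (\<Sum>i\<in>UNIV. card (small i)) + (\<Sum>d\<in>{K<..D}. \<Sum>ij\<in>UNIV. card (common d ij))"
    by (intro add_mono card_UN_le order_trans[OF card_UN_le sum_mono]) auto
  finally have "real (card (?X - generic_bases K)) \<le>
      (\<Sum>i\<in>UNIV. real (card (small i))) + (\<Sum>d\<in>{K<..D}. \<Sum>ij\<in>UNIV. real (card (common d ij)))"
    unfolding of_nat_sum [symmetric] of_nat_add [symmetric] of_nat_le_iff .
  also have "\<dots> \<le> (\<Sum>i\<in>UNIV. of_int H / of_int (N i) * real (card ?X)) +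
      (\<Sum>d\<in>{K<..D}. \<Sum>ij\<in>(UNIV :: ('n \<times> 'n) set). 1 / real d ^ 2 * real (card ?X))"
  proof (intro add_mono sum_mono)
    fix i
    have "small i \<subseteq> Pi\<^sub>E UNIV (\<lambda>k. if k = i then {1..H} else {1..N k})"
      by (auto simp: small_def PiE_iff)
    then have "card (small i) \<le> card (Pi\<^sub>E UNIV (\<lambda>k. if k = i then {1..H} else {1..N k}))"
      by (intro card_mono finite_PiE) auto
    also have "real \<dots> \<le> (\<Prod>k\<in>UNIV. if k = i then of_int H / of_int (N k) else 1) * real (card ?X)"
    proof (rule card_PiE_le_weighted)
      fix k show "real (card (if k = i then {1..H} else {1..N k})) \<le>
          (if k = i then of_int H / of_int (N k) else 1) * real (card {1..N k})"
        using N[of k] H by (cases "k = i") auto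
    qed
    finally show "real (card (small i)) \<le> of_int H / of_int (N i) * real (card ?X)" by simp
  next
    fix d and ij :: "'n \<times> 'n" assume "d \<in> {K<..D}"
    then have "int d > 0" using K by auto
    moreover have "N k \<ge> 0" for k using N[of k] by linarith
    ultimately show "real (card (common d ij)) \<le> 1 / real d ^ 2 * real (card ?X)"
      using card_common_multiples_le[of N "int d" "fst ij" "snd ij"] by (simp add: common_def)
  qed
  also have "\<dots> = ((\<Sum>i\<in>UNIV. of_int H / of_int (N i)) + (\<Sum>d\<in>{K<..D}. 1 / real d ^ 2) * real CARD('n) ^ 2) * real (card ?X)"
    by (simp add: sum_distrib_right sum_distrib_left power2_eq_square algebra_simps)
  also have "\<dots> \<le> ((\<Sum>i\<in>UNIV. of_int H / of_int (N i)) + 1 / real K * real CARD('n) ^ 2) * real (card ?X)"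
    using sum_inverse_squares_le[OF K, of D] by (intro mult_right_mono add_left_mono) auto
  finally show ?thesis by (simp add: H_def add.commute)
qed

section \<open>Counting nongeneric exponents\<close>

text \<open>As \<open>c j\<close> is nonzero, a solution is determined by its entries other than the
  one at \<open>j\<close>. Overwriting that entry by 0 is thus injective on solutions, and one of
  the factors \<open>2 * M j + 1\<close> is saved.\<close>

lemma card_linear_relation_le:
  fixes M c :: "'n::finite \<Rightarrow> int"
  assumes M: "\<And>k. M k \<ge> 0" and c: "c j \<noteq> 0"
  shows "real (card {b \<in> Pi\<^sub>E UNIV (\<lambda>k. {- M k..M k}). (\<Sum>k\<in>UNIV. c k * b k) = 0})
    \<le> 1 / of_int (2 * M j + 1) * real (card (Pi\<^sub>E UNIV (\<lambda>k. {- M k..M k})))"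
proof -
  let ?R = "{b \<in> Pi\<^sub>E UNIV (\<lambda>k. {- M k..M k}). (\<Sum>k\<in>UNIV. c k * b k) = 0}"
  let ?T = "\<lambda>k. if k = j then {0} else {- M k..M k}"
  have split: "(\<Sum>k\<in>UNIV. c k * b k) = c j * b j + (\<Sum>k\<in>UNIV - {j}. c k * b k)" for b
    by (rule sum.remove) auto
  have "inj_on (\<lambda>b. b(j := 0)) ?R"
  proof (rule inj_onI)
    fix b b' assume b: "b \<in> ?R" "b' \<in> ?R" and eq: "b(j := 0) = b'(j := 0)"
    then have other: "b k = b' k" if "k \<noteq> j" for k using that by (metis fun_upd_apply)
    then have "(\<Sum>k\<in>UNIV - {j}. c k * b k) = (\<Sum>k\<in>UNIV - {j}. c k * b' k)" by (intro sum.cong) auto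
    moreover have "(\<Sum>k\<in>UNIV. c k * b k) = 0" "(\<Sum>k\<in>UNIV. c k * b' k) = 0" using b by auto
    ultimately have "c j * b j = c j * b' j" using split[of b] split[of b'] by linarith
    then have "b j = b' j" using c by simp
    with other show "b = b'" by (metis ext)
  qed
  moreover have "(\<lambda>b. b(j := 0)) ` ?R \<subseteq> Pi\<^sub>E UNIV ?T" by (auto simp: PiE_iff)
  ultimately have "card ?R \<le> card (Pi\<^sub>E UNIV ?T)"
    by (rule card_inj_on_le) (auto intro: finite_PiE)
  also have "real \<dots> \<le> (\<Prod>k\<in>UNIV. if k = j then 1 / of_int (2 * M k + 1) else 1) *
      real (card (Pi\<^sub>E UNIV (\<lambda>k. {- M k..M k})))"
  proof (rule card_PiE_le_weighted)
    fix k show "real (card (?T k)) \<le>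
        (if k = j then 1 / of_int (2 * M k + 1) else 1) * real (card {- M k..M k})"
      using M[of k] by (cases "k = j") (simp_all add: of_nat_nat add_divide_distrib [symmetric])
  qed
  finally show ?thesis by simp
qed

text \<open>A union bound over the coefficient vectors, of which there are
  \<open>(4 * K + 1) ^ CARD('n)\<close>, and over the position of a nonzero coefficient.\<close>

lemma card_nongeneric_exponents_le:
  fixes M :: "'n::finite \<Rightarrow> int"
  assumes M: "\<And>k. M k \<ge> 0"
  shows "real (card (Pi\<^sub>E UNIV (\<lambda>k. {- M k..M k}) - generic_exponents K))
    \<le> real (4 * K + 1) ^ CARD('n) * (\<Sum>j\<in>UNIV. 1 / of_int (2 * M j + 1)) *
      real (card (Pi\<^sub>E UNIV (\<lambda>k. {- M k..M k})))"
proof -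
  let ?Y = "Pi\<^sub>E UNIV (\<lambda>k. {- M k..M k})"
  let ?C = "Pi\<^sub>E (UNIV :: 'n set) (\<lambda>k. {- (2 * int K)..2 * int K})"
  \<comment> \<open>With \<open>c j \<noteq> 0\<close> built in, \<open>R c j\<close> is empty at
    zero coefficients, and the sums can run over all \<open>c\<close> and \<open>j\<close>.\<close>
  define R where "R c j = {b \<in> ?Y. c j \<noteq> 0 \<and> (\<Sum>k\<in>UNIV. c k * b k) = 0}" for c j
  have fin: "finite ?C" "finite ?Y" by (auto intro!: finite_PiE)
  have "?Y - generic_exponents K \<subseteq> (\<Union>c\<in>?C. \<Union>j. R c j)"
  proof
    fix b assume b: "b \<in> ?Y - generic_exponents K"
    then obtain c j where "\<forall>i. \<bar>c i\<bar> \<le> 2 * int K" "(\<Sum>i\<in>UNIV. c i * b i) = 0" "c j \<noteq> 0"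
      unfolding generic_exponents_def by blast
    then have "c \<in> ?C" "b \<in> R c j" using b by (auto simp: R_def abs_le_iff PiE_iff minus_le_iff)
    then show "b \<in> (\<Union>c\<in>?C. \<Union>j. R c j)" by blast
  qed
  then have "card (?Y - generic_exponents K) \<le> card (\<Union>c\<in>?C. \<Union>j. R c j)"
    using fin by (intro card_mono) (auto simp: R_def)
  also have "\<dots> \<le> (\<Sum>c\<in>?C. \<Sum>j\<in>UNIV. card (R c j))"
    using fin by (intro order_trans[OF card_UN_le sum_mono] card_UN_le) auto
  finally have "real (card (?Y - generic_exponents K)) \<le> (\<Sum>c\<in>?C. \<Sum>j\<in>UNIV. real (card (R c j)))"
    unfolding of_nat_sum [symmetric] of_nat_le_iff .
  also have "\<dots> \<le> (\<Sum>c\<in>?C. \<Sum>j\<in>UNIV. 1 / of_int (2 * M j + 1) * real (card ?Y))"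
  proof (intro sum_mono)
    fix c j
    show "real (card (R c j)) \<le> 1 / of_int (2 * M j + 1) * real (card ?Y)"
    proof (cases "c j = 0")
      case True
      then show ?thesis using M[of j] by (simp add: R_def)
    next
      case False
      then show ?thesis using card_linear_relation_le[of M c j, OF M] by (simp add: R_def)
    qed
  qed
  also have "\<dots> = real (card ?C) * (\<Sum>j\<in>UNIV. 1 / of_int (2 * M j + 1)) * real (card ?Y)"
    by (simp add: sum_distrib_right mult.assoc)
  also have "card ?C = (4 * K + 1) ^ CARD('n)"
  proof -
    have "nat (4 * int K + 1) = 4 * K + 1" by simp
    then show ?thesis by (simp add: card_PiE)
  qed
  finally show ?thesis by simp
qed

section \<open>Almost full subsets of the box with uniqueness up to arbitrary permutations\<close>

lemma rep_box_eq_Times: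
  "rep_box A B = Pi\<^sub>E UNIV (\<lambda>k. {1..\<lfloor>A k\<rfloor>}) \<times> Pi\<^sub>E UNIV (\<lambda>k. {- \<lfloor>B k\<rfloor>..\<lfloor>B k\<rfloor>})"
proof -
  have "\<bar>real_of_int b\<bar> \<le> x \<longleftrightarrow> - \<lfloor>x\<rfloor> \<le> b \<and> b \<le> \<lfloor>x\<rfloor>" for b x
    by (auto simp: abs_le_iff le_floor_iff minus_le_iff [of _ b])
  then show ?thesis by (auto simp: rep_box_def PiE_iff le_floor_iff)
qed

lemma finite_rep_box: "finite (rep_box A B)"
  unfolding rep_box_eq_Times by (intro finite_cartesian_product finite_PiE) auto

text \<open>All permutations are allowed here, so that the notion refers neither to a filter nor to
  the parameters. Permissibility is enforced later by deleting tuples.\<close>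

definition unique_up_to_permutation :: "(('n::finite \<Rightarrow> int) \<times> ('n \<Rightarrow> int)) set \<Rightarrow> bool" where
  "unique_up_to_permutation X \<longleftrightarrow> (\<forall>a b e f. (a, b) \<in> X \<longrightarrow> (e, f) \<in> X \<longrightarrow>
     power_product a b = power_product e f \<longrightarrow> (\<exists>\<sigma>. \<sigma> permutes UNIV \<and> e = a \<circ> \<sigma> \<and> f = b \<circ> \<sigma>))"

text \<open>The threshold \<open>L\<close> depends only on \<open>\<epsilon>\<close> and the number
  of indices, not on how the parameters compare with each other. Half of \<open>\<epsilon>\<close>
  is spent on \<open>K\<close>, and the other half on a lower bound for the parameters in terms of
  \<open>K\<close>.\<close>

lemma exists_large_unique_subset:
  assumes "\<epsilon> > 0"
  shows "\<exists>L. \<forall>A B :: 'n::finite \<Rightarrow> real. (\<forall>i. L \<le> A i \<and> L \<le> B i) \<longrightarrow>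
    (\<exists>X\<subseteq>rep_box A B. unique_up_to_permutation X \<and>
      real (card (rep_box A B - X)) \<le> \<epsilon> * real (card (rep_box A B)))"
proof -
  let ?n = "real CARD('n)"
  obtain K where K: "K > 0" "?n ^ 2 / real K \<le> \<epsilon> / 2"
  proof -
    obtain K where K: "2 * ?n ^ 2 / \<epsilon> < real K" using reals_Archimedean2 by blast
    moreover have "0 \<le> 2 * ?n ^ 2 / \<epsilon>" using assms by simp
    ultimately have "K > 0" by (metis le_less_trans of_nat_0_less_iff)
    then show ?thesis using K assms by (intro that[of K]) (auto simp: field_simps)
  qed
  \<comment> \<open>The two summands are the constants, for fixed \<open>K\<close>, in the bounds
    for small bases and for linear relations. Both bounds decay like
    \<open>1 / real l\<close>.\<close>
  define C where "C = ?n * fact K ^ (2 * K) + ?n * real (4 * K + 1) ^ CARD('n)"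
  have C: "C \<ge> 0" by (simp add: C_def)
  obtain l :: nat where l: "l > 0" "C / real l \<le> \<epsilon> / 2"
  proof -
    obtain l where l: "2 * C / \<epsilon> < real l" using reals_Archimedean2 by blast
    moreover have "0 \<le> 2 * C / \<epsilon>" using assms C by simp
    ultimately have "l > 0" by (metis le_less_trans of_nat_0_less_iff)
    then show ?thesis using l assms by (intro that[of l]) (auto simp: field_simps)
  qed
  show ?thesis
  proof (intro exI[of _ "real l"] allI impI)
    fix A B :: "'n \<Rightarrow> real" assume AB: "\<forall>i. real l \<le> A i \<and> real l \<le> B i"
    have fl: "int l \<le> \<lfloor>A i\<rfloor>" "int l \<le> \<lfloor>B i\<rfloor>" for i
      using AB by (auto simp: le_floor_iff)
    have flr: "real l \<le> of_int \<lfloor>A i\<rfloor>" "real l \<le> of_int \<lfloor>B i\<rfloor>" for i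
      using fl[of i] by linarith+
    let ?P = "Pi\<^sub>E UNIV (\<lambda>k. {1..\<lfloor>A k\<rfloor>})" and ?Q = "Pi\<^sub>E UNIV (\<lambda>k. {- \<lfloor>B k\<rfloor>..\<lfloor>B k\<rfloor>})"
    define X where "X = (?P \<inter> generic_bases K) \<times> (?Q \<inter> generic_exponents K)"
    have fin: "finite ?P" "finite ?Q" by (auto intro!: finite_PiE)
    have sub: "X \<subseteq> rep_box A B" by (auto simp: X_def rep_box_eq_Times)
    have uniq: "unique_up_to_permutation X"
      unfolding unique_up_to_permutation_def X_def
      using generic_representation_unique[OF K(1)] by blast
    have "rep_box A B - X \<subseteq> (?P - generic_bases K) \<times> ?Q \<union> ?P \<times> (?Q - generic_exponents K)"
      by (auto simp: X_def rep_box_eq_Times)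
    then have "card (rep_box A B - X) \<le> card ((?P - generic_bases K) \<times> ?Q \<union> ?P \<times> (?Q - generic_exponents K))"
      using fin by (intro card_mono) auto
    also have "\<dots> \<le> card ((?P - generic_bases K) \<times> ?Q) + card (?P \<times> (?Q - generic_exponents K))"
      by (rule card_Un_le)
    finally have "card (rep_box A B - X) \<le>
        card (?P - generic_bases K) * card ?Q + card ?P * card (?Q - generic_exponents K)"
      by (simp only: card_cartesian_product)
    then have "real (card (rep_box A B - X)) \<le>
        real (card (?P - generic_bases K)) * real (card ?Q) + real (card ?P) * real (card (?Q - generic_exponents K))"
      by (simp only: of_nat_add [symmetric] of_nat_mult [symmetric] of_nat_le_iff)
    also have "\<dots> \<le> (?n ^ 2 / real K + ?n * fact K ^ (2 * K) / real l) * real (card ?P) * real (card ?Q) +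
        real (card ?P) * (real (4 * K + 1) ^ CARD('n) * (?n / real l) * real (card ?Q))"
    proof (intro add_mono mult_right_mono mult_left_mono)
      have "1 \<le> \<lfloor>A k\<rfloor>" for k using fl(1)[of k] l(1) by linarith
      then have "real (card (?P - generic_bases K)) \<le>
          (?n ^ 2 / real K + (\<Sum>i\<in>UNIV. fact K ^ (2 * K) / of_int \<lfloor>A i\<rfloor>)) * real (card ?P)"
        using K(1) by (rule card_nongeneric_bases_le)
      also have "(\<Sum>i\<in>UNIV. fact K ^ (2 * K) / of_int \<lfloor>A i\<rfloor>) \<le> (\<Sum>i\<in>(UNIV :: 'n set). fact K ^ (2 * K) / real l)"
      proof (intro sum_mono divide_left_mono)
        fix i
        have "0 < real_of_int \<lfloor>A i\<rfloor>" using flr(1)[of i] l(1) by linarith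
        then show "0 < real_of_int \<lfloor>A i\<rfloor> * real l" using l(1) by simp
      qed (use flr in auto)
      finally show "real (card (?P - generic_bases K)) \<le>
          (?n ^ 2 / real K + ?n * fact K ^ (2 * K) / real l) * real (card ?P)"
        by (simp add: mult_right_mono)
      have "0 \<le> \<lfloor>B k\<rfloor>" for k using fl(2)[of k] by linarith
      then have "real (card (?Q - generic_exponents K)) \<le>
          real (4 * K + 1) ^ CARD('n) * (\<Sum>i\<in>UNIV. 1 / of_int (2 * \<lfloor>B i\<rfloor> + 1)) * real (card ?Q)"
        by (rule card_nongeneric_exponents_le)
      also have "\<dots> \<le> real (4 * K + 1) ^ CARD('n) * (\<Sum>i\<in>(UNIV :: 'n set). 1 / real l) * real (card ?Q)"
      proof (intro mult_right_mono mult_left_mono sum_mono)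
        fix i
        have "real l \<le> of_int (2 * \<lfloor>B i\<rfloor> + 1)" using flr(2)[of i] by simp
        then show "1 / real_of_int (2 * \<lfloor>B i\<rfloor> + 1) \<le> 1 / real l"
          using l(1) by (intro divide_left_mono mult_pos_pos) auto
      qed auto
      finally show "real (card (?Q - generic_exponents K)) \<le>
          real (4 * K + 1) ^ CARD('n) * (?n / real l) * real (card ?Q)" by simp
    qed auto
    also have "\<dots> = (?n ^ 2 / real K + C / real l) * (real (card ?P) * real (card ?Q))"
      by (simp add: C_def algebra_simps add_divide_distrib)
    also have "\<dots> \<le> \<epsilon> * (real (card ?P) * real (card ?Q))"
      using add_mono[OF K(2) l(2)] by (intro mult_right_mono) simp_all
    also have "real (card ?P) * real (card ?Q) = real (card (rep_box A B))"
      by (simp only: rep_box_eq_Times card_cartesian_product of_nat_mult)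
    finally show "\<exists>X\<subseteq>rep_box A B. unique_up_to_permutation X \<and>
        real (card (rep_box A B - X)) \<le> \<epsilon> * real (card (rep_box A B))"
      using sub uniq by blast
  qed
qed

section \<open>Tuples versus permuted numbers, and the size of the box\<close>

text \<open>Permissibility counts rational numbers, whereas tuples are to be deleted. By uniqueness,
  the tuples in question that represent a given number are rearrangements of one of them, and each
  such tuple witnesses that \<open>\<sigma>\<close> permutes its number.\<close>

lemma card_permuted_le:
  fixes X :: "(('n::finite \<Rightarrow> int) \<times> ('n \<Rightarrow> int)) set"
  assumes X: "X \<subseteq> rep_box A B" "unique_up_to_permutation X"
  shows "real (card {(a, b) \<in> X. (a \<circ> \<sigma>, b \<circ> \<sigma>) \<in> rep_box A B})
    \<le> real (card {\<tau> :: 'n \<Rightarrow> 'n. \<tau> permutes UNIV}) * permuted_count \<sigma> (A, B)"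
proof -
  define Z where "Z = {(a, b) \<in> X. (a \<circ> \<sigma>, b \<circ> \<sigma>) \<in> rep_box A B}"
  define R where "R = {r \<in> power_products A B. permutes_rat A B \<sigma> r}"
  let ?S = "{\<tau> :: 'n \<Rightarrow> 'n. \<tau> permutes UNIV}"
  \<comment> \<open>One representative in \<open>Z\<close> is fixed for each number. The choice is
    arbitrary at numbers not represented in \<open>Z\<close>, but only numbers of tuples in
    \<open>Z\<close> are used for covering \<open>Z\<close>.\<close>
  define \<rho> where "\<rho> r = (SOME z. z \<in> Z \<and> case_prod power_product z = r)" for r
  have finR: "finite R"
  proof (rule finite_subset)
    show "R \<subseteq> case_prod power_product ` rep_box A B" by (auto simp: R_def power_products_def)
  qed (simp add: finite_rep_box)
  have finS: "finite ?S" using finite_permutations[of "UNIV :: 'n set"] by simp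
  have "Z \<subseteq> (\<lambda>(\<tau>, r). (fst (\<rho> r) \<circ> \<tau>, snd (\<rho> r) \<circ> \<tau>)) ` (?S \<times> R)"
  proof safe
    fix e f assume ef: "(e, f) \<in> Z"
    define r where "r = power_product e f"
    have "\<rho> r \<in> Z \<and> case_prod power_product (\<rho> r) = r"
      unfolding \<rho>_def by (rule someI[of _ "(e, f)"]) (use ef r_def in auto)
    then obtain a b where ab: "\<rho> r = (a, b)" "(a, b) \<in> Z" "power_product a b = power_product e f"
      by (cases "\<rho> r") (auto simp: r_def)
    then obtain \<tau> where "\<tau> permutes UNIV" "e = a \<circ> \<tau>" "f = b \<circ> \<tau>"
      using X(2) ef unfolding unique_up_to_permutation_def Z_def by blast
    moreover have "r \<in> R"
    proof -
      have "(e, f) \<in> rep_box A B" using ef X(1) by (auto simp: Z_def)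
      moreover have "(e \<circ> \<sigma>, f \<circ> \<sigma>) \<in> rep_box A B" using ef by (auto simp: Z_def)
      then have "\<forall>i. 1 \<le> e (\<sigma> i) \<and> of_int (e (\<sigma> i)) \<le> A i \<and> \<bar>of_int (f (\<sigma> i))\<bar> \<le> B i"
        by (simp add: rep_box_def)
      ultimately show ?thesis
        unfolding R_def power_products_def permutes_rat_def r_def by blast
    qed
    ultimately show "(e, f) \<in> (\<lambda>(\<tau>, r). (fst (\<rho> r) \<circ> \<tau>, snd (\<rho> r) \<circ> \<tau>)) ` (?S \<times> R)"
      using ab(1) by (intro image_eqI[of _ _ "(\<tau>, r)"]) auto
  qed
  then have "card Z \<le> card (?S \<times> R)"
    using finR finS by (intro surj_card_le[rotated]) auto
  then show ?thesis
    by (simp add: Z_def R_def permuted_count_def card_cartesian_product flip: of_nat_mult)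
qed

text \<open>The quotient of the two sides is a finite product of one-variable quotients, each
  tending to 1. Hence the relative growth of the parameters does not matter.\<close>

lemma card_rep_box_asymp_equiv:
  fixes F :: "(('n::finite \<Rightarrow> real) \<times> ('n \<Rightarrow> real)) filter"
  assumes F: "regime F"
  shows "(\<lambda>(A, B). real (card (rep_box A B)))
    \<sim>[F] (\<lambda>(A, B). 2 ^ CARD('n) * (\<Prod>i\<in>UNIV. A i) * (\<Prod>i\<in>UNIV. B i))"
proof (rule asymp_equivI')
  have A: "filterlim (\<lambda>p. fst p i) at_top F" and B: "filterlim (\<lambda>p. snd p i) at_top F" for i
    using F unfolding regime_def case_prod_beta by auto
  have lim1: "((\<lambda>x::real. of_int \<lfloor>x\<rfloor> / x) \<longlongrightarrow> 1) at_top" by real_asymp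
  have lim2: "((\<lambda>x::real. (2 * of_int \<lfloor>x\<rfloor> + 1) / (2 * x)) \<longlongrightarrow> 1) at_top" by real_asymp
  have "((\<lambda>p. (\<Prod>i\<in>UNIV. of_int \<lfloor>fst p i\<rfloor> / fst p i) *
      (\<Prod>i\<in>UNIV. (2 * of_int \<lfloor>snd p i\<rfloor> + 1) / (2 * snd p i))) \<longlongrightarrow> (\<Prod>i\<in>(UNIV::'n set). 1) * (\<Prod>i\<in>(UNIV::'n set). 1)) F"
    by (intro tendsto_mult tendsto_prod filterlim_compose[OF lim1 A] filterlim_compose[OF lim2 B])
  then have *: "((\<lambda>p. (\<Prod>i\<in>UNIV. of_int \<lfloor>fst p i\<rfloor> / fst p i) *
      (\<Prod>i\<in>UNIV. (2 * of_int \<lfloor>snd p i\<rfloor> + 1) / (2 * snd p i))) \<longlongrightarrow> (1::real)) F" by simp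
  \<comment> \<open>Nonnegative rounded parameters are needed for the interval lengths to be given
    by the formulas in the quotients.\<close>
  have "eventually (\<lambda>p. \<forall>i. 1 \<le> fst p i \<and> 1 \<le> snd p i) F"
    using A B unfolding filterlim_at_top by (intro eventually_all_finite eventually_conj) auto
  then have "eventually (\<lambda>p. (\<Prod>i\<in>UNIV. of_int \<lfloor>fst p i\<rfloor> / fst p i) *
      (\<Prod>i\<in>UNIV. (2 * of_int \<lfloor>snd p i\<rfloor> + 1) / (2 * snd p i)) =
      (case p of (A, B) \<Rightarrow> real (card (rep_box A B))) /
      (case p of (A, B) \<Rightarrow> 2 ^ CARD('n) * (\<Prod>i\<in>UNIV. A i) * (\<Prod>i\<in>UNIV. B i))) F"
  proof eventually_elim
    case (elim p)
    obtain A B where p: "p = (A, B)" by (cases p)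
    have "\<lfloor>A i\<rfloor> \<ge> 1" "\<lfloor>B i\<rfloor> \<ge> 1" for i using elim by (auto simp: p le_floor_iff)
    then have "\<lfloor>A i\<rfloor> \<ge> 0" "\<lfloor>B i\<rfloor> \<ge> 0" for i by (meson order_trans zero_le_one)+
    then have "real (card (rep_box A B)) = (\<Prod>i\<in>UNIV. of_int \<lfloor>A i\<rfloor>) * (\<Prod>i\<in>UNIV. 2 * of_int \<lfloor>B i\<rfloor> + 1)"
      by (simp add: rep_box_eq_Times card_cartesian_product card_PiE add.commute)
    then show ?case by (simp add: p prod_dividef prod.distrib)
  qed
  then show "((\<lambda>p. (case p of (A, B) \<Rightarrow> real (card (rep_box A B))) /
      (case p of (A, B) \<Rightarrow> 2 ^ CARD('n) * (\<Prod>i\<in>UNIV. A i) * (\<Prod>i\<in>UNIV. B i))) \<longlongrightarrow> 1) F"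
    using * by (rule Lim_transform_eventually[rotated])
qed

section \<open>Deletion of the tuples moved by non-permissible permutations\<close>

theorem mainTheorem1:
  fixes F :: "(('n::finite \<Rightarrow> real) \<times> ('n \<Rightarrow> real)) filter"
  assumes "regime F"
  shows "\<exists>E :: ('n \<Rightarrow> real) \<Rightarrow> ('n \<Rightarrow> real) \<Rightarrow> (('n \<Rightarrow> int) \<times> ('n \<Rightarrow> int)) set.
    (\<lambda>(A, B). real (card (E A B)))
      \<sim>[F] (\<lambda>(A, B). 2 ^ CARD('n) * (\<Prod>i\<in>UNIV. A i) * (\<Prod>i\<in>UNIV. B i)) \<and>
    (\<forall>A B. (\<forall>i. A i \<ge> 1 \<and> B i \<ge> 1) \<longrightarrow>
      E A B \<subseteq> rep_box A B \<and>
      (\<forall>a b e f. (a, b) \<in> E A B \<longrightarrow> (e, f) \<in> E A B \<longrightarrow>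
        power_product a b = power_product e f \<longrightarrow>
        (\<exists>\<sigma>. permissible F \<sigma> \<and> (\<forall>i. e i = a (\<sigma> i) \<and> f i = b (\<sigma> i)))))"
proof -
  \<comment> \<open>A subset of maximal cardinality is taken because it does not depend on
    \<open>\<epsilon>\<close>: it is at least as large as the subsets obtained for every
    \<open>\<epsilon>\<close>, so one family serves all of them.\<close>
  have "\<exists>X\<subseteq>rep_box A B. unique_up_to_permutation X \<and>
      (\<forall>Y\<subseteq>rep_box A B. unique_up_to_permutation Y \<longrightarrow> card Y \<le> card X)" for A B :: "'n \<Rightarrow> real"
  proof -
    have "\<exists>X. (X \<subseteq> rep_box A B \<and> unique_up_to_permutation X) \<and>
        (\<forall>Y. Y \<subseteq> rep_box A B \<and> unique_up_to_permutation Y \<longrightarrow> card Y \<le> card X)"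
    proof (rule ex_has_greatest_nat[where b = "Suc (card (rep_box A B))"])
      show "{} \<subseteq> rep_box A B \<and> unique_up_to_permutation ({} :: (('n \<Rightarrow> int) \<times> ('n \<Rightarrow> int)) set)"
        by (simp add: unique_up_to_permutation_def)
      show "\<forall>Y. Y \<subseteq> rep_box A B \<and> unique_up_to_permutation Y \<longrightarrow> card Y < Suc (card (rep_box A B))"
        by (intro allI impI le_imp_less_Suc card_mono finite_rep_box) simp
    qed
    then show ?thesis by blast
  qed
  then obtain E0 :: "('n \<Rightarrow> real) \<Rightarrow> ('n \<Rightarrow> real) \<Rightarrow> (('n \<Rightarrow> int) \<times> ('n \<Rightarrow> int)) set" where
    E0: "\<And>A B. E0 A B \<subseteq> rep_box A B" "\<And>A B. unique_up_to_permutation (E0 A B)"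
      "\<And>A B Y. Y \<subseteq> rep_box A B \<Longrightarrow> unique_up_to_permutation Y \<Longrightarrow> card Y \<le> card (E0 A B)"
    by metis
  \<comment> \<open>For each permutation in \<open>S\<close>, every tuple that it keeps inside the
    box is deleted, whether or not the rearranged tuple belongs to \<open>E0 A B\<close>. The number
    deleted is then controlled by \<open>permuted_count\<close>.\<close>
  define S where "S = {\<sigma> :: 'n \<Rightarrow> 'n. \<sigma> permutes UNIV \<and> \<not> permissible F \<sigma>}"
  define D where "D A B \<sigma> = {(a, b) \<in> E0 A B. (a \<circ> \<sigma>, b \<circ> \<sigma>) \<in> rep_box A B}" for A B \<sigma>
  define E where "E A B = E0 A B - (\<Union>\<sigma>\<in>S. D A B \<sigma>)" for A B
  let ?h = "\<lambda>p. real (card (rep_box (fst p) (snd p)))"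
  let ?g = "\<lambda>p. 2 ^ CARD('n) * (\<Prod>i\<in>UNIV. fst p i) * (\<Prod>i\<in>UNIV. snd p i) :: real"
  define N where "N = card {\<tau> :: 'n \<Rightarrow> 'n. \<tau> permutes UNIV}"
  have finS: "finite S"
    by (rule finite_subset[OF _ finite_permutations[of "UNIV :: 'n set"]]) (auto simp: S_def)
  have finE0: "finite (E0 A B)" for A B by (rule finite_subset[OF E0(1) finite_rep_box])
  have hg: "?h \<sim>[F] ?g" using card_rep_box_asymp_equiv[OF assms] by (simp add: case_prod_unfold)
  have large: "eventually (\<lambda>p. \<forall>i. L \<le> fst p i \<and> L \<le> snd p i) F" for L
    using assms unfolding regime_def case_prod_beta filterlim_at_top
    by (intro eventually_all_finite eventually_conj) auto
  have maximal: "(\<lambda>p. ?h p - real (card (E0 (fst p) (snd p)))) \<in> o[F](?h)"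
  proof (rule landau_o.smallI)
    fix \<epsilon> :: real assume "\<epsilon> > 0"
    from exists_large_unique_subset[OF this] obtain L where L:
      "\<And>A B :: 'n \<Rightarrow> real. \<forall>i. L \<le> A i \<and> L \<le> B i \<Longrightarrow> \<exists>X\<subseteq>rep_box A B. unique_up_to_permutation X \<and>
        real (card (rep_box A B - X)) \<le> \<epsilon> * real (card (rep_box A B))" by blast
    show "eventually (\<lambda>p. norm (?h p - real (card (E0 (fst p) (snd p)))) \<le> \<epsilon> * norm (?h p)) F"
      using large[of L]
    proof eventually_elim
      case (elim p)
      from L[OF elim] obtain X where X: "X \<subseteq> rep_box (fst p) (snd p)" "unique_up_to_permutation X"
        "real (card (rep_box (fst p) (snd p) - X)) \<le> \<epsilon> * ?h p" by blast
      have "real (card (rep_box (fst p) (snd p) - X)) = ?h p - real (card X)"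
        using X(1) by (simp add: card_Diff_subset finite_subset[OF _ finite_rep_box] of_nat_diff card_mono finite_rep_box)
      moreover have "card X \<le> card (E0 (fst p) (snd p))" by (rule E0(3)[OF X(1,2)])
      moreover have "card (E0 (fst p) (snd p)) \<le> card (rep_box (fst p) (snd p))"
        by (rule card_mono[OF finite_rep_box E0(1)])
      ultimately show ?case using X(3) by simp
    qed
  qed
  have removed: "(\<lambda>p. real (card (E0 (fst p) (snd p))) - real (card (E (fst p) (snd p)))) \<in> o[F](?g)"
  proof (rule landau_o.big_small_trans)
    show "(\<lambda>p. real (card (E0 (fst p) (snd p))) - real (card (E (fst p) (snd p))))
        \<in> O[F](\<lambda>p. \<Sum>\<sigma>\<in>S. real N * permuted_count \<sigma> p)"
    proof (rule landau_o.bigI[of 1])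
      have "norm (real (card (E0 A B)) - real (card (E A B))) \<le>
          (\<Sum>\<sigma>\<in>S. real N * permuted_count \<sigma> (A, B))" for A B
      proof -
        have "E0 A B - E A B \<subseteq> (\<Union>\<sigma>\<in>S. D A B \<sigma>)" by (auto simp: E_def)
        then have "card (E0 A B - E A B) \<le> card (\<Union>\<sigma>\<in>S. D A B \<sigma>)"
          using finS finE0[of A B] by (intro card_mono) (auto simp: D_def intro: finite_subset)
        also have "\<dots> \<le> (\<Sum>\<sigma>\<in>S. card (D A B \<sigma>))" by (rule card_UN_le[OF finS])
        finally have "real (card (E0 A B - E A B)) \<le> (\<Sum>\<sigma>\<in>S. real (card (D A B \<sigma>)))"
          by (simp only: of_nat_sum [symmetric] of_nat_le_iff)
        also have "\<dots> \<le> (\<Sum>\<sigma>\<in>S. real N * permuted_count \<sigma> (A, B))"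
          unfolding D_def N_def by (intro sum_mono card_permuted_le E0)
        finally have *: "real (card (E0 A B - E A B)) \<le> (\<Sum>\<sigma>\<in>S. real N * permuted_count \<sigma> (A, B))" .
        have sub: "E A B \<subseteq> E0 A B" by (auto simp: E_def)
        have "real (card (E0 A B - E A B)) = real (card (E0 A B)) - real (card (E A B))"
          using sub finE0[of A B] by (simp add: card_Diff_subset finite_subset[OF sub] of_nat_diff card_mono)
        with * show ?thesis using card_mono[OF finE0 sub] by simp
      qed
      from this[of "fst p" "snd p" for p]
      show "eventually (\<lambda>p. norm (real (card (E0 (fst p) (snd p))) - real (card (E (fst p) (snd p))))
          \<le> 1 * norm (\<Sum>\<sigma>\<in>S. real N * permuted_count \<sigma> p)) F"
        by (intro always_eventually allI) (simp add: order_trans[OF _ abs_ge_self])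
    qed simp
    \<comment> \<open>A permutation that is not permissible satisfies the \<open>o\<close>-bound
      along all of \<open>F\<close>, and \<open>S\<close> is finite.\<close>
    show "(\<lambda>p. \<Sum>\<sigma>\<in>S. real N * permuted_count \<sigma> p) \<in> o[F](?g)"
    proof (rule big_sum_in_smallo)
      fix \<sigma> assume "\<sigma> \<in> S"
      then have small: "permuted_count \<sigma> \<in> o[F](param_prod)"
        using permissible_iff_not_smallo[OF assms] by (auto simp: S_def)
      have g: "?g = (\<lambda>p. 2 ^ CARD('n) * param_prod p)"
        by (simp add: param_prod_def case_prod_unfold mult.assoc)
      show "(\<lambda>p. real N * permuted_count \<sigma> p) \<in> o[F](?g)"
        unfolding g using small by simp
    qed
  qed
  have "(\<lambda>p. ?h p - real (card (E0 (fst p) (snd p)))) \<in> o[F](?g)"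
    using maximal asymp_equiv_imp_bigo[OF hg] by (rule landau_o.small_big_trans)
  from sum_in_smallo(1)[OF this removed]
  have hE: "(\<lambda>p. ?h p - real (card (E (fst p) (snd p)))) \<in> o[F](?g)" by simp
  have "(\<lambda>p. ?h p - ?g p) \<in> o[F](?g)" using hg by (simp add: asymp_equiv_altdef)
  \<comment> \<open>Subtracting the two differences cancels the size of the box and leaves the size
    of \<open>E\<close> minus \<open>?g\<close>.\<close>
  from sum_in_smallo(2)[OF this hE]
  have "(\<lambda>p. real (card (E (fst p) (snd p)))) \<sim>[F] ?g" by (simp add: asymp_equiv_altdef)
  then have card_E: "(\<lambda>(A, B). real (card (E A B)))
      \<sim>[F] (\<lambda>(A, B). 2 ^ CARD('n) * (\<Prod>i\<in>UNIV. A i) * (\<Prod>i\<in>UNIV. B i))"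
    by (simp add: case_prod_unfold)
  have E_sub: "E A B \<subseteq> rep_box A B" for A B using E0(1) by (auto simp: E_def)
  have unique: "\<exists>\<sigma>. permissible F \<sigma> \<and> (\<forall>i. e i = a (\<sigma> i) \<and> f i = b (\<sigma> i))"
    if ab: "(a, b) \<in> E A B" and ef: "(e, f) \<in> E A B" and eq: "power_product a b = power_product e f"
    for A B a b e f
  proof -
    have E0_mem: "(a, b) \<in> E0 A B" "(e, f) \<in> E0 A B" using ab ef by (simp_all add: E_def)
    obtain \<sigma> where \<sigma>: "\<sigma> permutes UNIV" "e = a \<circ> \<sigma>" "f = b \<circ> \<sigma>"
      using E0(2)[of A B, unfolded unique_up_to_permutation_def, rule_format, OF E0_mem eq] by blast
    \<comment> \<open>The rearranged tuple is \<open>(e, f)\<close> itself and so lies in the box.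
      If \<open>\<sigma>\<close> were not permissible, \<open>(a, b)\<close> would have been
      deleted.\<close>
    have "(a \<circ> \<sigma>, b \<circ> \<sigma>) \<in> rep_box A B" using ef E_sub[of A B] \<sigma>(2,3) by auto
    then have "(a, b) \<in> D A B \<sigma>" using E0_mem(1) by (simp add: D_def)
    then have "\<sigma> \<notin> S" using ab by (auto simp: E_def)
    then have "permissible F \<sigma>" using \<sigma>(1) by (simp add: S_def)
    then show ?thesis using \<sigma> by auto
  qed
  show ?thesis
    by (intro exI[of _ E] conjI allI impI card_E E_sub) (rule unique)
qed

end
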